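(* In the monotone $S^2\times S^2$ (identified with the quadric surface $Q^2$), the monotone Gelfand--Zeitlin fibre $T^2_{\mathrm{GZ}}$ is Hamiltonian isotopic to the Chekanov torus $T^2_{\mathrm{Ch}}$.
   Context: $Q^2=\{[z_0:z_1:z_2:z_3]\in\mathbb{C}P^3: z_0^2+z_1^2+z_2^2+z_3^2=0\}$ with the restriction of the Fubini--Study form (lines having area $2\pi$). It is symplectomorphic to the monotone $S^2\times S^2$ (both factors of equal area, suitably normalized), by a symplectomorphism $\Phi$ carrying $Q^1=Q^2\cap\{z_3=0\}$ to the diagonal $\{(x,x)\}\subset S^2\times S^2$. $T^2_{\mathrm{GZ}}$ is regarded as a Lagrangian torus in $S^2\times S^2$ via $\Phi$. The monotone Gelfand--Zeitlin fibre is $T^2_{\mathrm{GZ}}=\{z\in Q^2:\lambda^{(2)}(z)=0,\ \lambda^{(3)}(z)=1\}$, where $$\lambda^{(2)}(z)=\frac{2}{|z|^2}\,i(z_0\bar z_1-\bar z_0z_1),\qquad \lambda^{(3)}(z)=\frac{2}{|z|^2}\Big(\big(\textstyle\sum_{j=0}^{2}|z_j|^2\big)^2-\big|\sum_{j=0}^{2}z_j^2\big|^2\Big)^{1/2}.$$ The Chekanov torus $T^2_{\mathrm{Ch}}$ is the standard exotic monotone Lagrangian torus in $S^2\times S^2$, well-defined up to Hamiltonian isotopy. Viewing $S^2$ as the unit sphere in $\mathbb{R}^3$, one representative of its Hamiltonian isotopy class is the Entov--Polterovich torus $\{(x,y)\in S^2\times S^2: x_3+y_3=0,\ x\cdot y=-\tfrac12\}$.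 Two Lagrangians are Hamiltonian isotopic if a Hamiltonian diffeomorphism maps one to the other. *)

theory Defs
  imports "HOL-Analysis.Analysis"
begin

section \<open>Smooth maps between subsets of Euclidean spaces\<close>

primrec Ck_on :: "nat \<Rightarrow> ('a::euclidean_space \<Rightarrow> 'b::euclidean_space) \<Rightarrow> 'a set \<Rightarrow> bool" where
  "Ck_on 0 f U \<longleftrightarrow> continuous_on U f"
| "Ck_on (Suc k) f U \<longleftrightarrow>
     (\<exists>f'. (\<forall>x\<in>U. (f has_derivative f' x) (at x)) \<and> (\<forall>v. Ck_on k (\<lambda>x. f' x v) U))"

text \<open>This is the usual notion of smoothness only when \<open>U\<close> is open.\<close>

definition smooth_on :: "('a::euclidean_space \<Rightarrow> 'b::euclidean_space) \<Rightarrow> 'a set \<Rightarrow> bool" where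
  "smooth_on f U \<longleftrightarrow> (\<forall>k. Ck_on k f U)"

text \<open>Smoothness on an arbitrary subset (here always an embedded submanifold) means that the map
  extends locally to a smooth map on an open subset of the ambient space.\<close>

definition smooth_map_on :: "('a::euclidean_space \<Rightarrow> 'b::euclidean_space) \<Rightarrow> 'a set \<Rightarrow> bool" where
  "smooth_map_on f X \<longleftrightarrow>
     (\<forall>p\<in>X. \<exists>U g. open U \<and> p \<in> U \<and> smooth_on g U \<and> (\<forall>q\<in>X \<inter> U. g q = f q))"


section \<open>Complex projective 3-space and the quadric surface\<close>

text \<open>The point \<open>[z\<^sub>0 : z\<^sub>1 : z\<^sub>2 : z\<^sub>3]\<close> is the class of \<open>z\<close>
  under rescaling, where \<open>z \<noteq> 0\<close>. The index type \<open>4\<close> has the elements \<open>0, 1, 2, 3\<close>.\<close>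

definition hcoord :: "complex^4 \<Rightarrow> (complex^4) set" where
  "hcoord z = {c *s z | c. c \<noteq> 0}"

definition quadric_cone :: "(complex^4) set" where
  "quadric_cone = {z. z \<noteq> 0 \<and> (z$0)^2 + (z$1)^2 + (z$2)^2 + (z$3)^2 = 0}"

definition Q2 :: "(complex^4) set set" where
  "Q2 = hcoord ` quadric_cone"

definition Q1 :: "(complex^4) set set" where
  "Q1 = hcoord ` {z \<in> quadric_cone. z$3 = 0}"

definition cone_tangent :: "complex^4 \<Rightarrow> (complex^4) set" where
  "cone_tangent z = {u. z$0 * u$0 + z$1 * u$1 + z$2 * u$2 + z$3 * u$3 = 0}"

definition hermitian :: "complex^4 \<Rightarrow> complex^4 \<Rightarrow> complex" where
  "hermitian u v = (\<Sum>j\<in>UNIV. cnj (u$j) * v$j)"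

text \<open>The pullback of the Fubini--Study form to the nonzero vectors. It vanishes on complex multiples
  of \<open>z\<close>. In the affine chart \<open>[1 : w : 0 : 0]\<close> of a line it is
  \<open>2 / (1 + |w|\<^sup>2)\<^sup>2\<close> times the Euclidean area form, of total area \<open>2\<pi>\<close>.\<close>

definition fubini_study :: "complex^4 \<Rightarrow> complex^4 \<Rightarrow> complex^4 \<Rightarrow> real" where
  "fubini_study z u v =
     2 * Im (hermitian u v / of_real ((norm z)^2)
             - hermitian u z * hermitian z v / of_real ((norm z)^4))"


section \<open>The product of two spheres\<close>

definition S2xS2 :: "((real^3) \<times> (real^3)) set" where
  "S2xS2 = sphere 0 1 \<times> sphere 0 1"

definition S2_diagonal :: "((real^3) \<times> (real^3)) set" where
  "S2_diagonal = {(x, x) | x. x \<in> sphere 0 1}"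

definition S2xS2_tangent :: "(real^3) \<times> (real^3) \<Rightarrow> ((real^3) \<times> (real^3)) set" where
  "S2xS2_tangent p = {(u, v). fst p \<bullet> u = 0 \<and> snd p \<bullet> v = 0}"

text \<open>On each factor the form is half of the standard area form, so that each sphere has area
  \<open>2\<pi>\<close>. This matches the normalisation of the Fubini--Study form, because the factors
  correspond to the lines contained in the quadric.\<close>

definition omega_S2xS2 ::
  "(real^3) \<times> (real^3) \<Rightarrow> (real^3) \<times> (real^3) \<Rightarrow> (real^3) \<times> (real^3) \<Rightarrow> real" where
  "omega_S2xS2 p u v =
     (fst p \<bullet> cross3 (fst u) (fst v) + snd p \<bullet> cross3 (snd u) (snd v)) / 2"


section \<open>Symplectomorphisms from the quadric to the product of spheres\<close>

text \<open>The projection \<open>hcoord\<close> from the cone to the quadric is a surjective submersion. Hence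
  a map defined on the quadric is smooth iff its composition with the projection is smooth, and a
  map into the quadric is smooth iff it is locally given by smooth homogeneous coordinates.
  Likewise, two forms on the quadric agree iff their pullbacks to the cone agree.\<close>

definition smooth_from_Q2 :: "((complex^4) set \<Rightarrow> (real^3) \<times> (real^3)) \<Rightarrow> bool" where
  "smooth_from_Q2 \<Phi> \<longleftrightarrow> smooth_map_on (\<Phi> \<circ> hcoord) quadric_cone"

definition smooth_into_Q2 :: "((real^3) \<times> (real^3) \<Rightarrow> (complex^4) set) \<Rightarrow> bool" where
  "smooth_into_Q2 \<Psi> \<longleftrightarrow>
     (\<forall>p\<in>S2xS2. \<exists>U h. open U \<and> p \<in> U \<and> smooth_on h U \<and>
        (\<forall>q\<in>S2xS2 \<inter> U. h q \<in> quadric_cone \<and> \<Psi> q = hcoord (h q)))"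

definition symplectomorphism_Q2_S2xS2 :: "((complex^4) set \<Rightarrow> (real^3) \<times> (real^3)) \<Rightarrow> bool" where
  "symplectomorphism_Q2_S2xS2 \<Phi> \<longleftrightarrow>
     bij_betw \<Phi> Q2 S2xS2 \<and>
     smooth_from_Q2 \<Phi> \<and>
     smooth_into_Q2 (inv_into Q2 \<Phi>) \<and>
     (\<forall>z\<in>quadric_cone. \<exists>D. ((\<Phi> \<circ> hcoord) has_derivative D) (at z within quadric_cone) \<and>
        (\<forall>u\<in>cone_tangent z. \<forall>v\<in>cone_tangent z.
           omega_S2xS2 (\<Phi> (hcoord z)) (D u) (D v) = fubini_study z u v))"


section \<open>Hamiltonian isotopy in the product of spheres\<close>

text \<open>A time-dependent Hamiltonian is given as a smooth function on the whole ambient space, which is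
  no restriction since every smooth function on the compact \<open>[0,1] \<times> S\<^sup>2 \<times> S\<^sup>2\<close> is the
  restriction of one. Only its derivatives tangent to \<open>S\<^sup>2 \<times> S\<^sup>2\<close> are used. Flows
  preserve \<open>S\<^sup>2 \<times> S\<^sup>2\<close> and are determined on it by \<open>H\<close>; values of \<open>\<phi>\<close>
  elsewhere are irrelevant.\<close>

definition hamiltonian_flow ::
  "(real \<times> ((real^3) \<times> (real^3)) \<Rightarrow> real) \<Rightarrow> (real \<Rightarrow> (real^3) \<times> (real^3) \<Rightarrow> (real^3) \<times> (real^3)) \<Rightarrow> bool" where
  "hamiltonian_flow H \<phi> \<longleftrightarrow>
     (\<forall>p\<in>S2xS2. \<phi> 0 p = p \<and>
        (\<forall>t\<in>{0..1}. \<phi> t p \<in> S2xS2 \<and>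
           (\<exists>X\<in>S2xS2_tangent (\<phi> t p).
              ((\<lambda>s. \<phi> s p) has_vector_derivative X) (at t within {0..1}) \<and>
              (\<forall>w\<in>S2xS2_tangent (\<phi> t p).
                 omega_S2xS2 (\<phi> t p) X w
                   = frechet_derivative (\<lambda>q. H (t, q)) (at (\<phi> t p)) w))))"

definition hamiltonian_diffeo :: "((real^3) \<times> (real^3) \<Rightarrow> (real^3) \<times> (real^3)) \<Rightarrow> bool" where
  "hamiltonian_diffeo \<psi> \<longleftrightarrow>
     (\<exists>H \<phi>. smooth_on H UNIV \<and> hamiltonian_flow H \<phi> \<and> (\<forall>p\<in>S2xS2. \<psi> p = \<phi> 1 p))"

definition hamiltonian_isotopic ::
  "((real^3) \<times> (real^3)) set \<Rightarrow> ((real^3) \<times> (real^3)) set \<Rightarrow> bool" where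
  "hamiltonian_isotopic L L' \<longleftrightarrow> (\<exists>\<psi>. hamiltonian_diffeo \<psi> \<and> \<psi> ` L = L')"


section \<open>The two tori\<close>

text \<open>Both functions are invariant under rescaling of \<open>z\<close>. The number inside \<open>Re\<close> is real.\<close>

definition GZ_lambda2 :: "complex^4 \<Rightarrow> real" where
  "GZ_lambda2 z = 2 / (norm z)^2 * Re (\<i> * (z$0 * cnj (z$1) - cnj (z$0) * z$1))"

definition GZ_lambda3 :: "complex^4 \<Rightarrow> real" where
  "GZ_lambda3 z = 2 / (norm z)^2 *
     sqrt (((cmod (z$0))^2 + (cmod (z$1))^2 + (cmod (z$2))^2)^2
           - (cmod ((z$0)^2 + (z$1)^2 + (z$2)^2))^2)"

definition GZ_torus :: "(complex^4) set set" where
  "GZ_torus = hcoord ` {z \<in> quadric_cone. GZ_lambda2 z = 0 \<and> GZ_lambda3 z = 1}"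

text \<open>The Chekanov torus is only defined up to Hamiltonian isotopy. It is represented by the
  Entov--Polterovich torus.\<close>

definition Chekanov_torus :: "((real^3) \<times> (real^3)) set" where
  "Chekanov_torus = {(x, y). (x, y) \<in> S2xS2 \<and> x$3 + y$3 = 0 \<and> x \<bullet> y = - 1 / 2}"

end

theory Submission
  imports Defs
begin

text \<open>
  The quadric surface is doubly ruled. In the coordinates \<open>z\<^sub>0 \<plusminus> i z\<^sub>1\<close> and
  \<open>z\<^sub>2 \<plusminus> i z\<^sub>3\<close> its equation says that a \<open>2 \<times> 2\<close> matrix is singular, so each
  point is the outer product of two spinors \<open>\<xi>\<close> and \<open>\<eta>\<close>, unique up to scale. Sending
  it to the pair of Hopf images of \<open>\<xi>\<close> and \<open>\<eta>\<close> identifies the quadric with the product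
  of two spheres. Written in \<open>z\<close>, this map is built from the real numbers
  \<open>Im (cnj z\<^sub>j \<cdot> z\<^sub>k) / |z|\<^sup>2\<close>: it sends the oriented plane spanned by the real and
  imaginary parts of \<open>z\<close> to the self-dual and anti-self-dual parts of its bivector. The first
  description (\<open>gauss_map_segre\<close>) yields bijectivity and a smooth inverse, the second one gives
  smoothness of the map itself.

  The map is symplectic because Hermitian products of outer products factor, so that the
  Fubini--Study form splits into one summand for each spinor (\<open>fubini_study_segre\<close>), and because
  the Hopf map takes the Fubini--Study form of the projective line to the area form
  (\<open>hopf_area\<close>).

  Under this map the Gelfand--Zeitlin functions become functions of the pair of points \<open>(x, y)\<close>:
  \<open>\<lambda>\<^sup>(\<^sup>2\<^sup>)\<close> is the sum of the heights \<open>x\<^sub>3 + y\<^sub>3\<close>, and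
  \<open>x \<bullet> y = 1 - 4 |z\<^sub>3|\<^sup>2 / |z|\<^sup>2\<close> is determined by
  \<open>\<lambda>\<^sup>(\<^sup>3\<^sup>)\<close>, which is the length of \<open>x + y\<close>. So the hyperplane section
  \<open>z\<^sub>3 = 0\<close> becomes the diagonal, and the conditions \<open>\<lambda>\<^sup>(\<^sup>2\<^sup>) = 0\<close> and
  \<open>\<lambda>\<^sup>(\<^sup>3\<^sup>) = 1\<close> become \<open>x\<^sub>3 + y\<^sub>3 = 0\<close> and
  \<open>x \<bullet> y = -1/2\<close>. The monotone fibre is mapped exactly onto the Entov--Polterovich torus, and the
  constant isotopy relates the two.
\<close>

section \<open>Calculus of smooth maps\<close>

lemma Ck_on_SucI:
  assumes "\<And>x. x \<in> U \<Longrightarrow> (f has_derivative f' x) (at x)" and "\<And>v. Ck_on k (\<lambda>x. f' x v) U"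
  shows "Ck_on (Suc k) f U"
  using assms by auto

lemma Ck_on_SucE:
  assumes "Ck_on (Suc k) f U"
  obtains f' where "\<And>x. x \<in> U \<Longrightarrow> (f has_derivative f' x) (at x)"
    and "\<And>v. Ck_on k (\<lambda>x. f' x v) U"
  using assms by auto

text \<open>Derivatives of products and reciprocals contain the undifferentiated factors again, so the
  inductions on the order of differentiability below have to lower the order of a given map.\<close>

lemma Ck_on_Suc_imp: "Ck_on (Suc k) f U \<Longrightarrow> Ck_on k f U"
proof (induction k arbitrary: f)
  case 0
  then show ?case
    by (metis Ck_on.simps(1) Ck_on_SucE continuous_at_imp_continuous_on has_derivative_continuous)
next
  case (Suc k)
  then show ?case by (metis Ck_on.simps(2))
qed

lemma Ck_on_const: "Ck_on k (\<lambda>x. c) U"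
proof (induction k arbitrary: c)
  case 0 then show ?case by simp
next
  case (Suc k)
  then show ?case by (auto intro!: exI[of _ "\<lambda>x v. 0"])
qed

lemma Ck_on_bounded_linear:
  assumes L: "bounded_linear L"
  shows "Ck_on k f U \<Longrightarrow> Ck_on k (\<lambda>x. L (f x)) U"
proof (induction k arbitrary: f)
  case 0
  then show ?case using bounded_linear.continuous_on[OF L] by simp
next
  case (Suc k)
  obtain f' where "(\<forall>x\<in>U. (f has_derivative f' x) (at x)) \<and> (\<forall>v. Ck_on k (\<lambda>x. f' x v) U)"
    using Suc.prems(1) by auto
  then have f': "\<And>x. x \<in> U \<Longrightarrow> (f has_derivative f' x) (at x)" "\<And>v. Ck_on k (\<lambda>x. f' x v) U"
    by auto
  then show ?case
    by (intro Ck_on_SucI[OF bounded_linear.has_derivative[OF L f'(1)]] Suc.IH f'(2))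
qed

lemma Ck_on_add: "Ck_on k f U \<Longrightarrow> Ck_on k g U \<Longrightarrow> Ck_on k (\<lambda>x. f x + g x) U"
proof (induction k arbitrary: f g)
  case 0
  then show ?case by (simp add: continuous_on_add)
next
  case (Suc k)
  obtain f' where "(\<forall>x\<in>U. (f has_derivative f' x) (at x)) \<and> (\<forall>v. Ck_on k (\<lambda>x. f' x v) U)"
    using Suc.prems(1) by auto
  then have f': "\<And>x. x \<in> U \<Longrightarrow> (f has_derivative f' x) (at x)" "\<And>v. Ck_on k (\<lambda>x. f' x v) U"
    by auto
  obtain g' where "(\<forall>x\<in>U. (g has_derivative g' x) (at x)) \<and> (\<forall>v. Ck_on k (\<lambda>x. g' x v) U)"
    using Suc.prems(2) by auto
  then have g': "\<And>x. x \<in> U \<Longrightarrow> (g has_derivative g' x) (at x)" "\<And>v. Ck_on k (\<lambda>x. g' x v) U"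
    by auto
  show ?case
    by (rule Ck_on_SucI[OF has_derivative_add[OF f'(1) g'(1)]]) (auto intro: Suc.IH f' g')
qed

lemma Ck_on_bounded_bilinear:
  assumes B: "bounded_bilinear B"
  shows "Ck_on k f U \<Longrightarrow> Ck_on k g U \<Longrightarrow> Ck_on k (\<lambda>x. B (f x) (g x)) U"
proof (induction k arbitrary: f g)
  case 0
  then show ?case using bounded_bilinear.continuous_on[OF B] by simp
next
  case (Suc k)
  obtain f' where "(\<forall>x\<in>U. (f has_derivative f' x) (at x)) \<and> (\<forall>v. Ck_on k (\<lambda>x. f' x v) U)"
    using Suc.prems(1) by auto
  then have f': "\<And>x. x \<in> U \<Longrightarrow> (f has_derivative f' x) (at x)" "\<And>v. Ck_on k (\<lambda>x. f' x v) U"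
    by auto
  obtain g' where "(\<forall>x\<in>U. (g has_derivative g' x) (at x)) \<and> (\<forall>v. Ck_on k (\<lambda>x. g' x v) U)"
    using Suc.prems(2) by auto
  then have g': "\<And>x. x \<in> U \<Longrightarrow> (g has_derivative g' x) (at x)" "\<And>v. Ck_on k (\<lambda>x. g' x v) U"
    by auto
  have "Ck_on k f U" "Ck_on k g U" using Suc.prems Ck_on_Suc_imp by blast+
  then show ?case
    by (intro Ck_on_SucI[OF bounded_bilinear.FDERIV[OF B f'(1) g'(1)]] Ck_on_add Suc.IH f' g')
qed

lemma Ck_on_inverse:
  fixes f :: "'a::euclidean_space \<Rightarrow> real"
  assumes nz: "\<And>x. x \<in> U \<Longrightarrow> f x \<noteq> 0"
  shows "Ck_on k f U \<Longrightarrow> Ck_on k (\<lambda>x. inverse (f x)) U"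
proof (induction k)
  case 0
  then show ?case using nz by (simp add: continuous_on_inverse)
next
  case (Suc k)
  obtain f' where "(\<forall>x\<in>U. (f has_derivative f' x) (at x)) \<and> (\<forall>v. Ck_on k (\<lambda>x. f' x v) U)"
    using Suc.prems(1) by auto
  then have f': "\<And>x. x \<in> U \<Longrightarrow> (f has_derivative f' x) (at x)" "\<And>v. Ck_on k (\<lambda>x. f' x v) U"
    by auto
  have I: "Ck_on k (\<lambda>x. inverse (f x)) U" using Suc Ck_on_Suc_imp by blast
  have "Ck_on k (\<lambda>x. - (inverse (f x) * f' x v * inverse (f x))) U" for v
    by (intro Ck_on_bounded_linear[OF bounded_linear_minus[OF bounded_linear_ident]]
        Ck_on_bounded_bilinear[OF bounded_bilinear_mult] I f'(2))
  then show ?case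
    by (intro Ck_on_SucI[OF Deriv.has_derivative_inverse[OF nz f'(1)]])
qed

lemma Ck_on_ident: "Ck_on k (\<lambda>x. x) U"
proof (cases k)
  case (Suc m)
  then show ?thesis using Ck_on_SucI[OF has_derivative_ident Ck_on_const] by simp
qed simp

lemma smooth_on_ident: "smooth_on (\<lambda>x. x) U"
  by (simp add: smooth_on_def Ck_on_ident)

lemma smooth_on_const: "smooth_on (\<lambda>x. c) U"
  by (simp add: smooth_on_def Ck_on_const)

lemma smooth_on_linear: "linear L \<Longrightarrow> smooth_on f U \<Longrightarrow> smooth_on (\<lambda>x. L (f x)) U"
  by (simp add: smooth_on_def Ck_on_bounded_linear linear_conv_bounded_linear)

lemma smooth_on_add: "smooth_on f U \<Longrightarrow> smooth_on g U \<Longrightarrow> smooth_on (\<lambda>x. f x + g x) U"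
  by (simp add: smooth_on_def Ck_on_add)

lemma smooth_on_bilinear:
  "bilinear B \<Longrightarrow> smooth_on f U \<Longrightarrow> smooth_on g U \<Longrightarrow> smooth_on (\<lambda>x. B (f x) (g x)) U"
  by (simp add: smooth_on_def Ck_on_bounded_bilinear bilinear_conv_bounded_bilinear)

lemma smooth_on_inverse:
  fixes f :: "'a::euclidean_space \<Rightarrow> real"
  shows "(\<And>x. x \<in> U \<Longrightarrow> f x \<noteq> 0) \<Longrightarrow> smooth_on f U \<Longrightarrow> smooth_on (\<lambda>x. inverse (f x)) U"
  by (simp add: smooth_on_def Ck_on_inverse)

lemma smooth_on_imp_differentiable: "smooth_on f U \<Longrightarrow> x \<in> U \<Longrightarrow> f differentiable (at x)"
  unfolding smooth_on_def differentiable_def by (metis Ck_on.simps(2))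

section \<open>The Hopf map\<close>

type_synonym spinor = "complex \<times> complex"

text \<open>Spinors are homogeneous coordinates on the Riemann sphere. The Pauli form is the vector of
  the real numbers \<open>Re (\<xi>\<^sup>* \<sigma>\<^sub>k \<eta>)\<close> for a basis of
  traceless Hermitian \<open>2 \<times> 2\<close> matrices \<open>\<sigma>\<^sub>k\<close>; the signs are chosen so that
  \<open>2 \<cdot> fst \<xi> / snd \<xi>\<close> agrees to first order with \<open>x\<^sub>1 + i x\<^sub>2\<close> at the north
  pole, which makes the Hopf map orientation preserving.\<close>

definition spinor_hermitian :: "spinor \<Rightarrow> spinor \<Rightarrow> complex" where
  "spinor_hermitian \<xi> \<eta> = cnj (fst \<xi>) * fst \<eta> + cnj (snd \<xi>) * snd \<eta>"

definition pauli_form :: "spinor \<Rightarrow> spinor \<Rightarrow> real^3" where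
  "pauli_form \<xi> \<eta> = vector [
     Re (cnj (fst \<xi>) * snd \<eta> + cnj (snd \<xi>) * fst \<eta>),
     Im (cnj (snd \<xi>) * fst \<eta> - cnj (fst \<xi>) * snd \<eta>),
     Re (cnj (snd \<xi>) * snd \<eta> - cnj (fst \<xi>) * fst \<eta>)]"

definition hopf :: "spinor \<Rightarrow> real^3" where
  "hopf \<xi> = inverse ((norm \<xi>)\<^sup>2) *\<^sub>R pauli_form \<xi> \<xi>"

lemma norm_spinor: "(norm \<xi>)\<^sup>2 = (cmod (fst \<xi>))\<^sup>2 + (cmod (snd \<xi>))\<^sup>2"
  by (simp add: norm_prod_def)

lemma spinor_hermitian_self: "spinor_hermitian \<xi> \<xi> = of_real ((norm \<xi>)\<^sup>2)"
  unfolding norm_spinor cmod_power2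
  by (simp add: spinor_hermitian_def complex_eq_iff power2_eq_square)

lemma bilinear_pauli_form: "bilinear pauli_form"
  unfolding bilinear_def
  by (auto intro!: linearI simp: pauli_form_def vec_eq_iff forall_3 algebra_simps)

lemma pauli_form_commute: "pauli_form \<xi> \<eta> = pauli_form \<eta> \<xi>"
  by (simp add: pauli_form_def vec_eq_iff forall_3)

lemma norm_real3: "(norm (x::real^3))\<^sup>2 = (x$1)\<^sup>2 + (x$2)\<^sup>2 + (x$3)\<^sup>2"
  by (simp add: norm_vec_def L2_set_def sum_3 sum_nonneg)

lemma norm_pauli_form: "norm (pauli_form \<xi> \<xi>) = (norm \<xi>)\<^sup>2"
proof -
  have "(norm (pauli_form \<xi> \<xi>))\<^sup>2 = ((norm \<xi>)\<^sup>2)\<^sup>2"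
    unfolding norm_real3 norm_spinor cmod_power2
    by (simp add: pauli_form_def) algebra
  then show ?thesis by (meson norm_ge_zero power2_eq_iff_nonneg zero_le_power2)
qed

lemma norm_hopf: "\<xi> \<noteq> 0 \<Longrightarrow> norm (hopf \<xi>) = 1"
  by (simp add: hopf_def norm_pauli_form)

text \<open>This polynomial identity is what makes the Hopf map carry the Fubini--Study form to the
  area form: the left-hand side is the area form of the sphere up to powers of the norm, and
  the right-hand side is the numerator of the Fubini--Study form of the projective line.\<close>

lemma pauli_form_triple:
  "pauli_form \<xi> \<xi> \<bullet> cross3 (pauli_form \<xi> \<alpha>) (pauli_form \<xi> \<beta>) =
     (norm \<xi>)\<^sup>2 * Im ((norm \<xi>)\<^sup>2 * spinor_hermitian \<alpha> \<beta>
                     - spinor_hermitian \<alpha> \<xi> * spinor_hermitian \<xi> \<beta>)"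
  unfolding norm_spinor cmod_power2
  by (simp add: pauli_form_def spinor_hermitian_def cross3_def inner_vec_def sum_3) algebra

text \<open>In the triple product the derivative of the normalising factor drops out, because it only
  contributes multiples of the first vector. What is left is the triple product of Pauli forms.\<close>

lemma hopf_area:
  assumes "\<xi> \<noteq> 0"
  obtains D where "(hopf has_derivative D) (at \<xi>)"
    and "\<And>\<alpha> \<beta>. hopf \<xi> \<bullet> cross3 (D \<alpha>) (D \<beta>) =
      4 * Im (spinor_hermitian \<alpha> \<beta> / of_real ((norm \<xi>)^2)
         - spinor_hermitian \<alpha> \<xi> * spinor_hermitian \<xi> \<beta> / of_real ((norm \<xi>)^4))"
proof -
  let ?n = "(norm \<xi>)\<^sup>2"
  \<comment> \<open>The derivative of the reciprocal of the squared norm.\<close>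
  define N where "N = (\<lambda>\<alpha>. - (inverse ?n * (2 * (\<xi> \<bullet> \<alpha>)) * inverse ?n))"
  define D where "D = (\<lambda>\<alpha>. inverse ?n *\<^sub>R (2 *\<^sub>R pauli_form \<xi> \<alpha>) + N \<alpha> *\<^sub>R pauli_form \<xi> \<xi>)"
  have nz: "?n \<noteq> 0" using assms by simp
  have B: "bounded_bilinear pauli_form"
    using bilinear_pauli_form by (simp add: bilinear_conv_bounded_bilinear)
  have pd: "((\<lambda>\<xi>. pauli_form \<xi> \<xi>) has_derivative (\<lambda>\<alpha>. 2 *\<^sub>R pauli_form \<xi> \<alpha>)) (at \<xi>)"
    using bounded_bilinear.FDERIV[OF B has_derivative_ident has_derivative_ident, of \<xi> UNIV]
    by (simp add: pauli_form_commute[of _ \<xi>] scaleR_2)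
  have nd: "((\<lambda>\<xi>. (norm \<xi>)\<^sup>2) has_derivative (\<lambda>\<alpha>. 2 * (\<xi> \<bullet> \<alpha>))) (at \<xi>)"
    unfolding power2_norm_eq_inner
    by (rule has_derivative_eq_rhs, (rule derivative_intros)+) (simp add: inner_commute)
  have "(hopf has_derivative D) (at \<xi>)"
    unfolding hopf_def D_def N_def
    by (rule has_derivative_scaleR[OF Deriv.has_derivative_inverse[OF nz nd] pd])
  moreover
  have "hopf \<xi> \<bullet> cross3 (D \<alpha>) (D \<beta>) =
      4 * Im (spinor_hermitian \<alpha> \<beta> / of_real ((norm \<xi>)^2)
         - spinor_hermitian \<alpha> \<xi> * spinor_hermitian \<xi> \<beta> / of_real ((norm \<xi>)^4))" for \<alpha> \<beta>
  proof -
    have "hopf \<xi> \<bullet> cross3 (D \<alpha>) (D \<beta>) = 4 / ?n^3 * (pauli_form \<xi> \<xi> \<bullet> cross3 (pauli_form \<xi> \<alpha>) (pauli_form \<xi> \<beta>))"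
      by (simp add: hopf_def D_def cross_add_left cross_add_right cross_mult_left cross_mult_right
          inner_add_right dot_cross_self power3_eq_cube divide_simps)
    also have "\<dots> = 4 / ?n\<^sup>2 * Im (?n * spinor_hermitian \<alpha> \<beta>
                     - spinor_hermitian \<alpha> \<xi> * spinor_hermitian \<xi> \<beta>)"
      using nz by (simp only: pauli_form_triple) (simp add: power3_eq_cube power2_eq_square)
    also have "\<dots> = 4 * Im ((?n * spinor_hermitian \<alpha> \<beta>
                     - spinor_hermitian \<alpha> \<xi> * spinor_hermitian \<xi> \<beta>) / of_real (?n\<^sup>2))"
      by (subst Im_divide_of_real) simp
    also have "(?n * spinor_hermitian \<alpha> \<beta>
                     - spinor_hermitian \<alpha> \<xi> * spinor_hermitian \<xi> \<beta>) / of_real (?n\<^sup>2)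
      = spinor_hermitian \<alpha> \<beta> / of_real ((norm \<xi>)^2)
         - spinor_hermitian \<alpha> \<xi> * spinor_hermitian \<xi> \<beta> / of_real ((norm \<xi>)^4)"
      using assms by (simp add: field_simps power2_eq_square power4_eq_xxxx)
    finally show ?thesis .
  qed
  ultimately show thesis by (rule that)
qed


section \<open>The Segre parametrisation\<close>

text \<open>The library enumerates the four-element index type from 1 to 4, whereas homogeneous
  coordinates start with index 0.\<close>

lemma four_eq_0: "(4::4) = 0"
  by simp

lemma UNIV_4_from_0: "(UNIV :: 4 set) = {0, 1, 2, 3}"
  unfolding UNIV_4 four_eq_0 by auto

lemma forall_4_from_0: "(\<forall>j::4. P j) \<longleftrightarrow> P 0 \<and> P 1 \<and> P 2 \<and> P 3"
  unfolding forall_4 four_eq_0 by auto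

lemma sum_4_from_0: "sum f (UNIV :: 4 set) = f 0 + f 1 + f 2 + f 3"
  unfolding UNIV_4_from_0 by (simp add: add.assoc)

text \<open>In the coordinates \<open>z\<^sub>0 \<plusminus> i z\<^sub>1\<close> and \<open>z\<^sub>2 \<plusminus> i z\<^sub>3\<close> the quadric is the
  determinant of a \<open>2 \<times> 2\<close> matrix, so its cone consists of the matrices of rank one, which are
  the outer products of two spinors. The formula is this outer product, written in the original
  coordinates; one sign is changed to fit the equation \<open>p q + r s = 0\<close>.\<close>

definition segre :: "spinor \<Rightarrow> spinor \<Rightarrow> complex^4" where
  "segre \<xi> \<eta> = (\<chi> j.
     if j = 0 then (fst \<xi> * fst \<eta> - snd \<xi> * snd \<eta>) / 2
     else if j = 1 then - \<i> * (fst \<xi> * fst \<eta> + snd \<xi> * snd \<eta>) / 2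
     else if j = 2 then (snd \<xi> * fst \<eta> + fst \<xi> * snd \<eta>) / 2
     else - \<i> * (snd \<xi> * fst \<eta> - fst \<xi> * snd \<eta>) / 2)"

lemma segre_nth:
  "segre \<xi> \<eta> $ 0 = (fst \<xi> * fst \<eta> - snd \<xi> * snd \<eta>) / 2"
  "segre \<xi> \<eta> $ 1 = - \<i> * (fst \<xi> * fst \<eta> + snd \<xi> * snd \<eta>) / 2"
  "segre \<xi> \<eta> $ 2 = (snd \<xi> * fst \<eta> + fst \<xi> * snd \<eta>) / 2"
  "segre \<xi> \<eta> $ 3 = - \<i> * (snd \<xi> * fst \<eta> - fst \<xi> * snd \<eta>) / 2"
  by (simp_all add: segre_def)

lemma bilinear_segre: "bilinear segre"
  unfolding bilinear_def
  by (auto intro!: linearI simp: segre_nth vec_eq_iff forall_4_from_0;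
      simp add: scaleR_conv_of_real field_simps)

text \<open>Hermitian products of decomposable tensors factor. This is why the Fubini--Study form of
  the quadric splits into those of the two rulings.\<close>

lemma hermitian_segre:
  "hermitian (segre \<xi> \<eta>) (segre \<xi>' \<eta>') = spinor_hermitian \<xi> \<xi>' * spinor_hermitian \<eta> \<eta>' / 2"
  by (simp add: hermitian_def sum_4_from_0 segre_nth spinor_hermitian_def field_simps)

lemma hermitian_self: "hermitian z z = of_real ((norm z)\<^sup>2)"
  by (simp add: hermitian_def norm_vec_def L2_set_def sum_nonneg complex_norm_square mult.commute
      del: of_real_power)

lemma norm_segre: "(norm (segre \<xi> \<eta>))\<^sup>2 = (norm \<xi>)\<^sup>2 * (norm \<eta>)\<^sup>2 / 2"
proof -
  have "complex_of_real ((norm (segre \<xi> \<eta>))\<^sup>2) = of_real ((norm \<xi>)\<^sup>2 * (norm \<eta>)\<^sup>2 / 2)"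
    by (simp only: hermitian_self[symmetric] hermitian_segre spinor_hermitian_self of_real_mult
        of_real_divide of_real_numeral)
  then show ?thesis by (simp only: of_real_eq_iff)
qed

lemma segre_eq_0_iff: "segre \<xi> \<eta> = 0 \<longleftrightarrow> \<xi> = 0 \<or> \<eta> = 0"
  using norm_segre[of \<xi> \<eta>] by (auto simp: bilinear_lzero bilinear_rzero bilinear_segre)

lemma segre_in_cone: "\<xi> \<noteq> 0 \<Longrightarrow> \<eta> \<noteq> 0 \<Longrightarrow> segre \<xi> \<eta> \<in> quadric_cone"
  by (simp add: quadric_cone_def segre_eq_0_iff) (simp add: segre_nth power2_eq_square field_simps)

text \<open>The four matrix entries of a vector, in the order \<open>(p, r, s, q)\<close> for which the quadratic
  form is \<open>p q + r s\<close>.\<close>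

definition rank_coord :: "complex^4 \<Rightarrow> complex \<times> complex \<times> complex \<times> complex" where
  "rank_coord z = (z$0 + \<i> * z$1, z$2 + \<i> * z$3, z$2 - \<i> * z$3, z$0 - \<i> * z$1)"

lemma rank_coord_eq_iff: "rank_coord z = rank_coord w \<longleftrightarrow> z = w"
proof
  assume "rank_coord z = rank_coord w"
  then have "(z$0 + \<i> * z$1) + (z$0 - \<i> * z$1) = (w$0 + \<i> * w$1) + (w$0 - \<i> * w$1)"
    "(z$0 + \<i> * z$1) - (z$0 - \<i> * z$1) = (w$0 + \<i> * w$1) - (w$0 - \<i> * w$1)"
    "(z$2 + \<i> * z$3) + (z$2 - \<i> * z$3) = (w$2 + \<i> * w$3) + (w$2 - \<i> * w$3)"
    "(z$2 + \<i> * z$3) - (z$2 - \<i> * z$3) = (w$2 + \<i> * w$3) - (w$2 - \<i> * w$3)"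
    by (simp_all add: rank_coord_def)
  then show "z = w" by (simp add: vec_eq_iff forall_4_from_0)
qed simp

lemma rank_coord_segre:
  "rank_coord (segre \<xi> \<eta>) = (fst \<xi> * fst \<eta>, snd \<xi> * fst \<eta>, fst \<xi> * snd \<eta>, - (snd \<xi> * snd \<eta>))"
  by (simp add: rank_coord_def segre_nth field_simps)

lemma rank_coord_add: 
  "rank_coord (z + w) = rank_coord z + rank_coord w"
  by (simp add: rank_coord_def algebra_simps)

lemma rank_one_decomposition:
  fixes p q r s :: complex
  assumes "p * q + r * s = 0"
  obtains a b c d where "p = a * c" "r = b * c" "s = a * d" "q = - (b * d)"
proof -
  consider "p \<noteq> 0" | "p = 0" "r = 0" | "p = 0" "s = 0" "r \<noteq> 0"
    using assms by (metis add_0 mult_eq_0_iff)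
  then show thesis
  proof cases
    case 1
    show ?thesis
      by (rule that[where a = p and b = r and c = 1 and d = "s / p"]) (use 1 assms in \<open>auto simp: field_simps eq_neg_iff_add_eq_0\<close>)
  next
    case 2
    show ?thesis by (rule that[where a = s and b = "-q" and c = 0 and d = 1]) (use 2 in auto)
  next
    case 3
    show ?thesis by (rule that[where a = 0 and b = r and c = 1 and d = "-q/r"]) (use 3 in auto)
  qed
qed

lemma cone_segreE:
  assumes "z \<in> quadric_cone"
  obtains \<xi> \<eta> where "\<xi> \<noteq> 0" "\<eta> \<noteq> 0" "z = segre \<xi> \<eta>"
proof -
  have "(z$0 + \<i> * z$1) * (z$0 - \<i> * z$1) + (z$2 + \<i> * z$3) * (z$2 - \<i> * z$3) = 0"
    using assms by (simp add: quadric_cone_def power2_eq_square algebra_simps)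
  then obtain a b c d where
    "z$0 + \<i> * z$1 = a * c" "z$2 + \<i> * z$3 = b * c" "z$2 - \<i> * z$3 = a * d"
    "z$0 - \<i> * z$1 = - (b * d)"
    by (rule rank_one_decomposition)
  then have "rank_coord z = rank_coord (segre (a, b) (c, d))"
    unfolding rank_coord_segre by (simp add: rank_coord_def)
  then have eq: "z = segre (a, b) (c, d)" by (simp only: rank_coord_eq_iff)
  moreover have "z \<noteq> 0" using assms by (simp add: quadric_cone_def)
  ultimately show thesis using that segre_eq_0_iff by blast
qed

text \<open>The tangent space of the rank one matrices at an outer product consists of the derivatives of
  outer products. These are determined only up to rescaling one spinor against the other; each case
  sets the component of the first spinor's variation to zero where that spinor does not vanish.\<close>

lemma rank_one_tangent:
  fixes a b c d P Q R S :: complex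
  assumes "(a, b) \<noteq> 0" "(c, d) \<noteq> 0"
    and "a * c * Q - b * d * P + b * c * S + a * d * R = 0"
  obtains a' b' c' d' where
    "P = a' * c + a * c'" "R = b' * c + b * c'" "S = a' * d + a * d'" "Q = - (b' * d + b * d')"
proof -
  consider "a \<noteq> 0" "c \<noteq> 0" | "a \<noteq> 0" "d \<noteq> 0" | "b \<noteq> 0" "c \<noteq> 0" | "b \<noteq> 0" "d \<noteq> 0"
    using assms(1,2) by (auto simp: zero_prod_def)
  then show thesis
  proof cases
    case 1
    show ?thesis
    proof (rule that[where a' = 0 and b' = "(R - b * (P / a)) / c" and c' = "P / a" and d' = "S / a"])
      have "a * c * Q = b * d * P - b * c * S - a * d * R" using assms(3) by algebra
      then show "Q = - ((R - b * (P / a)) / c * d + b * (S / a))" using 1 by (simp add: field_simps)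
    qed (use 1 in auto)
  next
    case 2
    show ?thesis
    proof (rule that[where a' = 0 and b' = "- (Q + b * (S / a)) / d" and c' = "P / a" and d' = "S / a"])
      have "a * d * R = b * d * P - b * c * S - a * c * Q" using assms(3) by algebra
      then show "R = - (Q + b * (S / a)) / d * c + b * (P / a)" using 2 by (simp add: field_simps)
    qed (use 2 in auto)
  next
    case 3
    show ?thesis
    proof (rule that[where a' = "(P - a * (R / b)) / c" and b' = 0 and c' = "R / b" and d' = "- Q / b"])
      have "b * c * S = b * d * P - a * c * Q - a * d * R" using assms(3) by algebra
      then show "S = (P - a * (R / b)) / c * d + a * (- Q / b)" using 3 by (simp add: field_simps) algebra
    qed (use 3 in auto)
  next
    case 4
    show ?thesis
    proof (rule that[where a' = "(S - a * (- Q / b)) / d" and b' = 0 and c' = "R / b" and d' = "- Q / b"])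
      have "b * d * P = a * c * Q + b * c * S + a * d * R" using assms(3) by algebra
      then show "P = (S - a * (- Q / b)) / d * c + a * (R / b)" using 4 by (simp add: field_simps)
    qed (use 4 in auto)
  qed
qed

lemma cone_tangent_segreE:
  assumes "\<xi> \<noteq> 0" "\<eta> \<noteq> 0" "u \<in> cone_tangent (segre \<xi> \<eta>)"
  obtains \<alpha> \<beta> where "u = segre \<alpha> \<eta> + segre \<xi> \<beta>"
proof -
  let ?z = "segre \<xi> \<eta>"
  have "(?z$0 + \<i> * ?z$1) * (u$0 - \<i> * u$1) + (?z$0 - \<i> * ?z$1) * (u$0 + \<i> * u$1)
    + (?z$2 + \<i> * ?z$3) * (u$2 - \<i> * u$3) + (?z$2 - \<i> * ?z$3) * (u$2 + \<i> * u$3)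
    = 2 * (?z$0 * u$0 + ?z$1 * u$1 + ?z$2 * u$2 + ?z$3 * u$3)"
    by (simp add: algebra_simps)
  also have "\<dots> = 0" using assms(3) by (simp add: cone_tangent_def)
  finally have "fst \<xi> * fst \<eta> * (u$0 - \<i> * u$1) - snd \<xi> * snd \<eta> * (u$0 + \<i> * u$1)
      + snd \<xi> * fst \<eta> * (u$2 - \<i> * u$3) + fst \<xi> * snd \<eta> * (u$2 + \<i> * u$3) = 0"
    using rank_coord_segre[of \<xi> \<eta>] by (simp add: rank_coord_def)
  moreover have "(fst \<xi>, snd \<xi>) \<noteq> 0" "(fst \<eta>, snd \<eta>) \<noteq> 0" using assms by auto
  ultimately obtain a b c d where
    "u$0 + \<i> * u$1 = a * fst \<eta> + fst \<xi> * c" "u$2 + \<i> * u$3 = b * fst \<eta> + snd \<xi> * c"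
    "u$2 - \<i> * u$3 = a * snd \<eta> + fst \<xi> * d" "u$0 - \<i> * u$1 = - (b * snd \<eta> + snd \<xi> * d)"
    using rank_one_tangent by metis
  then have "rank_coord u = rank_coord (segre (a, b) \<eta> + segre \<xi> (c, d))"
    unfolding rank_coord_add rank_coord_segre by (simp add: rank_coord_def)
  then have "u = segre (a, b) \<eta> + segre \<xi> (c, d)" by (simp only: rank_coord_eq_iff)
  then show thesis by (rule that)
qed

text \<open>The mixed terms of the first summand, such as
  \<open>\<langle>\<alpha>, \<xi>\<rangle> \<langle>\<eta>, \<beta>'\<rangle>\<close>, are cancelled by those of the correction term.\<close>

lemma fubini_study_segre:
  assumes "\<xi> \<noteq> 0" "\<eta> \<noteq> 0"
  shows "fubini_study (segre \<xi> \<eta>) (segre \<alpha> \<eta> + segre \<xi> \<beta>) (segre \<alpha>' \<eta> + segre \<xi> \<beta>') =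
     2 * Im (spinor_hermitian \<alpha> \<alpha>' / of_real ((norm \<xi>)^2)
         - spinor_hermitian \<alpha> \<xi> * spinor_hermitian \<xi> \<alpha>' / of_real ((norm \<xi>)^4))
   + 2 * Im (spinor_hermitian \<beta> \<beta>' / of_real ((norm \<eta>)^2)
         - spinor_hermitian \<beta> \<eta> * spinor_hermitian \<eta> \<beta>' / of_real ((norm \<eta>)^4))"
proof -
  have add: "hermitian (u + v) w = hermitian u w + hermitian v w"
    "hermitian w (u + v) = hermitian w u + hermitian w v" for u v w
    by (simp_all add: hermitian_def sum_4_from_0 algebra_simps)
  define m n where "m = complex_of_real ((norm \<xi>)\<^sup>2)" and "n = complex_of_real ((norm \<eta>)\<^sup>2)"
  have nz: "m \<noteq> 0" "n \<noteq> 0" using assms by (auto simp: m_def n_def)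
  have n2: "of_real ((norm (segre \<xi> \<eta>))\<^sup>2) = m * n / 2"
    by (simp add: norm_segre m_def n_def)
  have p4: "complex_of_real ((norm x)^4) = (of_real ((norm x)\<^sup>2))\<^sup>2" for x :: "'z::real_normed_vector"
    by simp
  have sq: "spinor_hermitian \<xi> \<xi> = m" "spinor_hermitian \<eta> \<eta> = n"
    by (simp_all only: spinor_hermitian_self m_def n_def)
  show ?thesis
    unfolding fubini_study_def p4 n2 add hermitian_segre m_def[symmetric] n_def[symmetric] sq
      distrib_left[symmetric] plus_complex.sel(2)[symmetric]
    by (rule arg_cong[where f = "\<lambda>x. 2 * Im x"])
      (use nz in \<open>simp add: field_simps power2_eq_square\<close>)
qed


section \<open>The map from the quadric to the product of spheres\<close>

definition plucker :: "4 \<Rightarrow> 4 \<Rightarrow> complex^4 \<Rightarrow> real" where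
  "plucker j k z = Im (cnj (z$j) * z$k)"

text \<open>For a point of the quadric, the real and imaginary parts of \<open>z\<close> span an oriented plane in
  \<open>\<real>\<^sup>4\<close>, whose Pluecker coordinates form a decomposable bivector. Its self-dual and
  anti-self-dual parts have equal length, and after normalisation they give the two points of the
  sphere.\<close>

definition self_dual_part :: "complex^4 \<Rightarrow> real^3" where
  "self_dual_part z = vector
     [plucker 1 2 z + plucker 3 0 z, plucker 2 0 z + plucker 3 1 z, plucker 0 1 z + plucker 3 2 z]"

definition anti_self_dual_part :: "complex^4 \<Rightarrow> real^3" where
  "anti_self_dual_part z = vector
     [plucker 1 2 z - plucker 3 0 z, plucker 2 0 z - plucker 3 1 z, plucker 0 1 z - plucker 3 2 z]"

definition gauss_map :: "complex^4 \<Rightarrow> (real^3) \<times> (real^3)" where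
  "gauss_map z = (2 * inverse ((norm z)\<^sup>2)) *\<^sub>R (self_dual_part z, anti_self_dual_part z)"

lemma dual_parts_segre:
  "self_dual_part (segre \<xi> \<eta>) = ((norm \<eta>)\<^sup>2 / 4) *\<^sub>R pauli_form \<xi> \<xi>"
  "anti_self_dual_part (segre \<xi> \<eta>) = ((norm \<xi>)\<^sup>2 / 4) *\<^sub>R pauli_form \<eta> \<eta>"
  unfolding norm_spinor cmod_power2
  by (simp_all add: self_dual_part_def anti_self_dual_part_def plucker_def pauli_form_def segre_nth
      vec_eq_iff forall_3) (simp_all add: field_simps power2_eq_square)

text \<open>The self-dual part of an outer product depends on the second spinor only through its norm,
  and vice versa. So the map is the product of two Hopf maps on the two rulings; all its properties
  are read off from this formula.\<close>

lemma gauss_map_segre: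
  assumes "\<xi> \<noteq> 0" "\<eta> \<noteq> 0"
  shows "gauss_map (segre \<xi> \<eta>) = (hopf \<xi>, hopf \<eta>)"
  using assms by (simp add: gauss_map_def dual_parts_segre norm_segre hopf_def field_simps)

lemma gauss_map_scale: "c \<noteq> 0 \<Longrightarrow> gauss_map (c *s z) = gauss_map z"
proof -
  assume c: "c \<noteq> 0"
  have "plucker j k (c *s z) = (cmod c)\<^sup>2 * plucker j k z" for j k
  proof -
    have "cnj (c * z$j) * (c * z$k) = of_real ((cmod c)\<^sup>2) * (cnj (z$j) * z$k)"
      unfolding complex_norm_square by (simp only: complex_cnj_mult ac_simps)
    then have "Im (cnj (c * z$j) * (c * z$k)) = (cmod c)\<^sup>2 * Im (cnj (z$j) * z$k)"
      by (metis scaleR_conv_of_real scaleR_complex.sel(2))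
    then show ?thesis by (simp only: plucker_def vector_smult_component)
  qed
  then have "self_dual_part (c *s z) = (cmod c)\<^sup>2 *\<^sub>R self_dual_part z"
    "anti_self_dual_part (c *s z) = (cmod c)\<^sup>2 *\<^sub>R anti_self_dual_part z"
    by (simp_all add: self_dual_part_def anti_self_dual_part_def vec_eq_iff forall_3 algebra_simps)
  moreover have "(norm (c *s z))\<^sup>2 = (cmod c)\<^sup>2 * (norm z)\<^sup>2"
    by (simp add: norm_vec_def L2_set_def sum_nonneg norm_mult power_mult_distrib sum_distrib_left)
  ultimately show ?thesis using c by (simp add: gauss_map_def field_simps)
qed

definition quadric_to_spheres :: "(complex^4) set \<Rightarrow> (real^3) \<times> (real^3)" where
  "quadric_to_spheres S = gauss_map (SOME z. z \<in> S)"

lemma quadric_to_spheres_hcoord: "quadric_to_spheres (hcoord z) = gauss_map z"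
proof -
  have "z \<in> hcoord z" unfolding hcoord_def by (auto intro!: exI[of _ 1])
  then have "(SOME w. w \<in> hcoord z) \<in> hcoord z" by (rule someI)
  then obtain c where "c \<noteq> 0" "(SOME w. w \<in> hcoord z) = c *s z" unfolding hcoord_def by blast
  then show ?thesis by (simp add: quadric_to_spheres_def gauss_map_scale)
qed

lemma hcoord_scale: assumes "c \<noteq> 0" shows "hcoord (c *s z) = hcoord z"
proof -
  have "\<exists>e. d *s z = e *s (c *s z) \<and> e \<noteq> 0" if "d \<noteq> 0" for d
    using assms that by (intro exI[of _ "d / c"]) (simp add: vector_smult_assoc)
  moreover have "\<exists>e. d *s (c *s z) = e *s z \<and> e \<noteq> 0" if "d \<noteq> 0" for d
    using assms that by (intro exI[of _ "d * c"]) (simp add: vector_smult_assoc)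
  ultimately show ?thesis unfolding hcoord_def by (auto; metis)
qed

section \<open>The inverse from local sections of the Hopf map\<close>

text \<open>Applying the rank one projector with axis \<open>x\<close> to the two basis spinors gives these
  vectors, up to a factor 2. The result is affine in \<open>x\<close>, and at each point at least one of
  the two is nonzero, so that smooth local lifts of the Hopf map exist everywhere.\<close>

definition hopf_section :: "bool \<Rightarrow> real^3 \<Rightarrow> spinor" where
  "hopf_section b x = (if b then (Complex (x$1) (x$2), of_real (1 + x$3))
     else (of_real (1 - x$3), Complex (x$1) (- x$2)))"

definition spinor_component :: "bool \<Rightarrow> spinor \<Rightarrow> complex" where
  "spinor_component b \<xi> = (if b then snd \<xi> else fst \<xi>)"

lemma hopf_section_nonzero: "\<exists>b. hopf_section b x \<noteq> 0"
proof -
  have "complex_of_real (1 + x$3) \<noteq> 0 \<or> complex_of_real (1 - x$3) \<noteq> 0"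
    unfolding of_real_eq_0_iff by linarith
  then have "hopf_section True x \<noteq> 0 \<or> hopf_section False x \<noteq> 0"
    unfolding hopf_section_def zero_prod_def by (metis Pair_inject)
  then show ?thesis by blast
qed

lemma hopf_hopf_section:
  assumes "norm x = 1" "hopf_section b x \<noteq> 0"
  shows "hopf (hopf_section b x) = x"
proof -
  have s: "x$2 * x$2 = 1 - x$1 * x$1 - x$3 * x$3"
    using assms(1) norm_real3[of x] by (simp add: power2_eq_square)
  define t where "t = (if b then 2 * (1 + x$3) else 2 * (1 - x$3))"
  have n: "(norm (hopf_section b x))\<^sup>2 = t"
    unfolding norm_spinor cmod_power2
    by (simp add: hopf_section_def t_def power2_eq_square algebra_simps s)
  have "pauli_form (hopf_section b x) (hopf_section b x) = t *\<^sub>R x"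
    by (simp add: hopf_section_def pauli_form_def t_def vec_eq_iff forall_3 algebra_simps s)
  moreover have "t \<noteq> 0" using n assms(2) by auto
  ultimately show ?thesis by (simp add: hopf_def n)
qed

definition spinor_scale :: "complex \<Rightarrow> spinor \<Rightarrow> spinor" where
  "spinor_scale c \<xi> = (c * fst \<xi>, c * snd \<xi>)"

lemma segre_scale: "segre (spinor_scale c \<xi>) (spinor_scale d \<eta>) = (c * d) *s segre \<xi> \<eta>"
  by (simp add: vec_eq_iff forall_4_from_0 segre_nth spinor_scale_def field_simps)

text \<open>Projecting a basis spinor to the line of \<open>\<xi>\<close> yields a multiple of \<open>\<xi>\<close>. Hence the Hopf
  map determines the line, which gives injectivity.\<close>

lemma hopf_section_hopf:
  assumes "\<xi> \<noteq> 0"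
  shows "hopf_section b (hopf \<xi>) =
    spinor_scale (2 * cnj (spinor_component b \<xi>) / of_real ((norm \<xi>)\<^sup>2)) \<xi>"
proof -
  have "(norm \<xi>)\<^sup>2 \<noteq> 0" using assms by simp
  moreover have "(norm \<xi>)\<^sup>2 = (Re (fst \<xi>))\<^sup>2 + (Im (fst \<xi>))\<^sup>2 + ((Re (snd \<xi>))\<^sup>2 + (Im (snd \<xi>))\<^sup>2)"
    unfolding norm_spinor cmod_power2 ..
  ultimately show ?thesis
    by (cases b) (simp_all add: hopf_section_def hopf_def pauli_form_def spinor_scale_def spinor_component_def
      complex_eq_iff field_simps Re_divide_of_real Im_divide_of_real del: of_real_power,
        (simp add: power2_eq_square algebra_simps)+)
qed

lemma hopf_eq_imp_proportional:
  assumes "\<xi> \<noteq> 0" "\<xi>' \<noteq> 0" "hopf \<xi> = hopf \<xi>'"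
  obtains c where "c \<noteq> 0" "\<xi>' = spinor_scale c \<xi>"
proof -
  obtain b where b: "hopf_section b (hopf \<xi>) \<noteq> 0" using hopf_section_nonzero by blast
  define d where "d \<zeta> = 2 * cnj (spinor_component b \<zeta>) / of_real ((norm \<zeta>)\<^sup>2)" for \<zeta>
  have eq: "spinor_scale (d \<xi>) \<xi> = spinor_scale (d \<xi>') \<xi>'"
    using hopf_section_hopf assms unfolding d_def by metis
  have "spinor_scale (d \<xi>) \<xi> \<noteq> 0"
    using b hopf_section_hopf[OF assms(1), of b] by (simp add: d_def)
  moreover have "spinor_scale 0 \<zeta> = 0" for \<zeta> by (simp add: spinor_scale_def zero_prod_def)
  ultimately have "d \<xi> \<noteq> 0" "d \<xi>' \<noteq> 0" using eq by metis+
  then show thesis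
    using eq by (intro that[of "d \<xi> / d \<xi>'"]) (auto simp: spinor_scale_def prod_eq_iff field_simps)
qed

lemma gauss_map_in_S2xS2:
  assumes "z \<in> quadric_cone"
  shows "gauss_map z \<in> S2xS2"
  using cone_segreE[OF assms] gauss_map_segre norm_hopf
  by (metis S2xS2_def SigmaI dist_0_norm mem_sphere)

lemma bij_quadric_to_spheres: "bij_betw quadric_to_spheres Q2 S2xS2"
  unfolding bij_betw_def
proof
  show "inj_on quadric_to_spheres Q2"
  proof (rule inj_onI)
    fix S T assume "S \<in> Q2" "T \<in> Q2" and eq: "quadric_to_spheres S = quadric_to_spheres T"
    then obtain z w where zw: "S = hcoord z" "T = hcoord w" "z \<in> quadric_cone" "w \<in> quadric_cone"
      unfolding Q2_def by blast
    obtain \<xi> \<eta> where z: "\<xi> \<noteq> 0" "\<eta> \<noteq> 0" "z = segre \<xi> \<eta>" using cone_segreE zw(3) by blast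
    obtain \<xi>' \<eta>' where w: "\<xi>' \<noteq> 0" "\<eta>' \<noteq> 0" "w = segre \<xi>' \<eta>'" using cone_segreE zw(4) by blast
    have "hopf \<xi> = hopf \<xi>'" "hopf \<eta> = hopf \<eta>'"
      using eq by (simp_all add: zw z w quadric_to_spheres_hcoord gauss_map_segre)
    then obtain c d where "c \<noteq> 0" "d \<noteq> 0" "\<xi>' = spinor_scale c \<xi>" "\<eta>' = spinor_scale d \<eta>"
      using hopf_eq_imp_proportional z w by metis
    then show "S = T" by (simp add: zw z w segre_scale hcoord_scale)
  qed
  show "quadric_to_spheres ` Q2 = S2xS2"
  proof (intro equalityI subsetI)
    fix p assume "p \<in> quadric_to_spheres ` Q2"
    then obtain z where z: "z \<in> quadric_cone" "p = gauss_map z"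
      unfolding Q2_def by (auto simp: quadric_to_spheres_hcoord)
    then show "p \<in> S2xS2"
      by (simp add: gauss_map_in_S2xS2)
  next
    fix p assume "p \<in> S2xS2"
    then obtain x y where p: "p = (x, y)" "norm x = 1" "norm y = 1"
      by (auto simp: S2xS2_def)
    obtain b c where bc: "hopf_section b x \<noteq> 0" "hopf_section c y \<noteq> 0"
      using hopf_section_nonzero by metis
    then have "p = quadric_to_spheres (hcoord (segre (hopf_section b x) (hopf_section c y)))"
      by (simp add: p quadric_to_spheres_hcoord gauss_map_segre hopf_hopf_section)
    then show "p \<in> quadric_to_spheres ` Q2"
      unfolding Q2_def using segre_in_cone[OF bc] by blast
  qed
qed

section \<open>Smoothness in both directions\<close>

lemma smooth_on_Pair:
  assumes "smooth_on f U" "smooth_on g U"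
  shows "smooth_on (\<lambda>x. (f x, g x)) U"
proof -
  have "smooth_on (\<lambda>x. (f x, 0) + (0, g x)) U"
    by (intro smooth_on_add smooth_on_linear[of "\<lambda>u. (u, 0)"] smooth_on_linear[of "\<lambda>u. (0, u)"] assms)
      (auto intro!: linearI)
  then show ?thesis by simp
qed

lemma smooth_on_vector_3:
  fixes f g h :: "'a::euclidean_space \<Rightarrow> real"
  assumes "smooth_on f U" "smooth_on g U" "smooth_on h U"
  shows "smooth_on (\<lambda>x. vector [f x, g x, h x] :: real^3) U"
proof -
  have "smooth_on (\<lambda>x. f x *\<^sub>R axis 1 1 + g x *\<^sub>R axis 2 1 + h x *\<^sub>R axis 3 1 :: real^3) U"
    by (intro smooth_on_add smooth_on_linear[of "\<lambda>u. u *\<^sub>R _"] assms)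
      (auto intro!: linearI simp: scaleR_left_distrib)
  moreover have "f x *\<^sub>R axis 1 1 + g x *\<^sub>R axis 2 1 + h x *\<^sub>R axis 3 1 = (vector [f x, g x, h x] :: real^3)" for x
    by (simp add: vec_eq_iff forall_3 axis_def)
  ultimately show ?thesis by simp
qed

lemma smooth_plucker: "smooth_on (plucker j k) U"
proof -
  have "bilinear (\<lambda>z w :: complex^4. Im (cnj (z$j) * w$k))"
    unfolding bilinear_def by (auto intro!: linearI simp: algebra_simps)
  from smooth_on_bilinear[OF this smooth_on_ident smooth_on_ident]
  show ?thesis by (simp add: plucker_def[abs_def])
qed

lemma smooth_gauss_map: "smooth_on gauss_map (- {0})"
proof -
  have diff: "smooth_on (\<lambda>x. f x - g x) U" if "smooth_on f U" "smooth_on g U"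
    for f g :: "complex^4 \<Rightarrow> real" and U
    using smooth_on_add[OF that(1) smooth_on_linear[OF _ that(2), of uminus]]
    by (simp add: linear_uminus)
  have "bilinear (\<lambda>z w :: complex^4. z \<bullet> w)" 
    by (simp add: bilinear_conv_bounded_bilinear bounded_bilinear_inner)
  from smooth_on_bilinear[OF this smooth_on_ident smooth_on_ident]
  have "smooth_on (\<lambda>z :: complex^4. (norm z)\<^sup>2) (- {0})" by (simp add: power2_norm_eq_inner)
  moreover have "bilinear (\<lambda>r p. (2 * r) *\<^sub>R (p :: (real^3) \<times> (real^3)))"
    unfolding bilinear_def by (auto intro!: linearI simp: algebra_simps)
  ultimately show ?thesis
    unfolding gauss_map_def[abs_def] self_dual_part_def anti_self_dual_part_def
    by (intro smooth_on_bilinear[where B = "\<lambda>r p. (2 * r) *\<^sub>R p"] smooth_on_inverse smooth_on_Pair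
        smooth_on_vector_3 smooth_on_add diff smooth_plucker) auto
qed

lemma smooth_hopf_section:
  assumes "smooth_on f U"
  shows "smooth_on (\<lambda>x. hopf_section b (f x)) U"
proof -
  define K where "K = hopf_section b 0"
  have "linear (\<lambda>x. hopf_section b x - K)"
    by (rule linearI) (auto simp: K_def hopf_section_def complex_eq_iff algebra_simps)
  from smooth_on_add[OF smooth_on_linear[OF this assms] smooth_on_const[of K]]
  show ?thesis by simp
qed

lemma smooth_from_quadric: "smooth_from_Q2 quadric_to_spheres"
  unfolding smooth_from_Q2_def smooth_map_on_def
  using smooth_gauss_map
  by (auto intro!: exI[of _ "- {0}"] exI[of _ gauss_map] simp: quadric_cone_def quadric_to_spheres_hcoord)

lemma smooth_into_quadric: "smooth_into_Q2 (inv_into Q2 quadric_to_spheres)"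
  unfolding smooth_into_Q2_def
proof
  fix p assume "p \<in> S2xS2"
  obtain b c where bc: "hopf_section b (fst p) \<noteq> 0" "hopf_section c (snd p) \<noteq> 0"
    using hopf_section_nonzero by metis
  define h where "h q = segre (hopf_section b (fst q)) (hopf_section c (snd q))" for q
  have sm: "smooth_on h V" for V
    unfolding h_def[abs_def]
    by (intro smooth_on_bilinear[OF bilinear_segre] smooth_hopf_section
        smooth_on_linear[OF linear_fst smooth_on_ident] smooth_on_linear[OF linear_snd smooth_on_ident])
  define U where "U = {q. h q \<noteq> 0}"
  have "continuous_on UNIV h"
    using sm[of UNIV] unfolding smooth_on_def by (metis Ck_on.simps(1))
  then have "open U" unfolding U_def
    by (intro open_Collect_neq continuous_on_const)
  moreover have "p \<in> U" using bc by (simp add: U_def h_def segre_eq_0_iff)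
  moreover have "h q \<in> quadric_cone \<and> inv_into Q2 quadric_to_spheres q = hcoord (h q)"
    if "q \<in> S2xS2 \<inter> U" for q
  proof -
    have nz: "hopf_section b (fst q) \<noteq> 0" "hopf_section c (snd q) \<noteq> 0"
      using that by (auto simp: U_def h_def segre_eq_0_iff)
    then have cone: "h q \<in> quadric_cone" unfolding h_def by (rule segre_in_cone)
    have "quadric_to_spheres (hcoord (h q)) = q"
      using that nz by (auto simp: h_def quadric_to_spheres_hcoord gauss_map_segre hopf_hopf_section S2xS2_def)
    with cone show ?thesis
      using bij_quadric_to_spheres unfolding Q2_def by (metis bij_betw_def image_eqI inv_into_f_f)
  qed
  ultimately show "\<exists>U h. open U \<and> p \<in> U \<and> smooth_on h U \<and>
        (\<forall>q\<in>S2xS2 \<inter> U. h q \<in> quadric_cone \<and> inv_into Q2 quadric_to_spheres q = hcoord (h q))"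
    using sm by blast
qed

section \<open>Comparison of the symplectic forms\<close>

text \<open>The derivative of the composition with the Segre map is the product of the derivatives of two
  Hopf maps. By the chain rule this determines the derivative of the map on all tangent vectors of
  the cone, and there both forms split into the same two summands.\<close>

lemma quadric_to_spheres_symplectic:
  assumes "z \<in> quadric_cone"
  shows "\<exists>D. ((quadric_to_spheres \<circ> hcoord) has_derivative D) (at z within quadric_cone) \<and>
        (\<forall>u\<in>cone_tangent z. \<forall>v\<in>cone_tangent z.
           omega_S2xS2 (quadric_to_spheres (hcoord z)) (D u) (D v) = fubini_study z u v)"
proof -
  obtain \<xi> \<eta> where nz: "\<xi> \<noteq> 0" "\<eta> \<noteq> 0" and z: "z = segre \<xi> \<eta>" using cone_segreE assms by blast
  have "z \<noteq> 0" using assms by (simp add: quadric_cone_def)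
  then obtain D where D: "(gauss_map has_derivative D) (at z)"
    using smooth_on_imp_differentiable[OF smooth_gauss_map] unfolding differentiable_def by fastforce
  obtain A where A: "(hopf has_derivative A) (at \<xi>)"
    "\<And>\<alpha> \<beta>. hopf \<xi> \<bullet> cross3 (A \<alpha>) (A \<beta>) =
      4 * Im (spinor_hermitian \<alpha> \<beta> / of_real ((norm \<xi>)^2)
         - spinor_hermitian \<alpha> \<xi> * spinor_hermitian \<xi> \<beta> / of_real ((norm \<xi>)^4))"
    using hopf_area[OF nz(1)] by blast
  obtain B where B: "(hopf has_derivative B) (at \<eta>)"
    "\<And>\<alpha> \<beta>. hopf \<eta> \<bullet> cross3 (B \<alpha>) (B \<beta>) =
      4 * Im (spinor_hermitian \<alpha> \<beta> / of_real ((norm \<eta>)^2)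
         - spinor_hermitian \<alpha> \<eta> * spinor_hermitian \<eta> \<beta> / of_real ((norm \<eta>)^4))"
    using hopf_area[OF nz(2)] by blast
  have DAB: "D (segre \<alpha> \<eta> + segre \<xi> \<beta>) = (A \<alpha>, B \<beta>)" for \<alpha> \<beta>
  proof -
    let ?S = "\<lambda>p. segre (fst p) (snd p)"
    have S: "(?S has_derivative (\<lambda>p. segre \<xi> (snd p) + segre (fst p) \<eta>)) (at (\<xi>, \<eta>))"
      using bounded_bilinear.FDERIV[OF bilinear_segre[unfolded bilinear_conv_bounded_bilinear]
          has_derivative_fst[OF has_derivative_ident] has_derivative_snd[OF has_derivative_ident],
          of "(\<xi>, \<eta>)" UNIV] by simp
    have "((\<lambda>p. gauss_map (?S p)) has_derivative (\<lambda>p. D (segre \<xi> (snd p) + segre (fst p) \<eta>))) (at (\<xi>, \<eta>))"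
      by (rule has_derivative_compose[OF S]) (use D z in simp)
    then have 1: "((\<lambda>p. (hopf (fst p), hopf (snd p))) has_derivative
        (\<lambda>p. D (segre \<xi> (snd p) + segre (fst p) \<eta>))) (at (\<xi>, \<eta>))"
    proof (rule has_derivative_transform_within_open)
      show "open ((- {0}) \<times> (- {0}) :: (spinor \<times> spinor) set)" by (intro open_Times) auto
      show "gauss_map (?S p) = (hopf (fst p), hopf (snd p))" if "p \<in> (- {0}) \<times> (- {0})" for p
        by (rule gauss_map_segre) (use that in auto)
    qed (use nz in auto)
    have 2: "((\<lambda>p. (hopf (fst p), hopf (snd p))) has_derivative (\<lambda>p. (A (fst p), B (snd p)))) (at (\<xi>, \<eta>))"
      by (intro has_derivative_Pair
          has_derivative_compose[OF has_derivative_fst[OF has_derivative_ident]]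
          has_derivative_compose[OF has_derivative_snd[OF has_derivative_ident]])
        (use A B in simp_all)
    from has_derivative_unique[OF 1 2] have "D (segre \<xi> \<beta> + segre \<alpha> \<eta>) = (A \<alpha>, B \<beta>)"
      by (metis fst_conv snd_conv)
    then show ?thesis by (simp add: add.commute)
  qed
  have "((quadric_to_spheres \<circ> hcoord) has_derivative D) (at z within quadric_cone)"
    using has_derivative_at_withinI[OF D] by (simp add: comp_def quadric_to_spheres_hcoord)
  moreover have "omega_S2xS2 (quadric_to_spheres (hcoord z)) (D u) (D v) = fubini_study z u v"
    if uv: "u \<in> cone_tangent z" "v \<in> cone_tangent z" for u v
  proof -
    obtain \<alpha> \<beta> where u: "u = segre \<alpha> \<eta> + segre \<xi> \<beta>" using cone_tangent_segreE[OF nz] uv(1) z by metis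
    obtain \<alpha>' \<beta>' where v: "v = segre \<alpha>' \<eta> + segre \<xi> \<beta>'" using cone_tangent_segreE[OF nz] uv(2) z by metis
    show ?thesis
      unfolding u v DAB quadric_to_spheres_hcoord z gauss_map_segre[OF nz] fubini_study_segre[OF nz]
        omega_S2xS2_def fst_conv snd_conv A(2) B(2)
      by (simp add: field_simps)
  qed
  ultimately show ?thesis by blast
qed

section \<open>The images of the hyperplane section and of the torus\<close>

text \<open>The squared modulus of \<open>z\<^sub>3\<close> is, up to a factor, that of the determinant of the two
  spinors, which measures the distance of the two points on the sphere. It therefore controls both
  the preimage of the diagonal and the level of \<open>\<lambda>\<^sup>(\<^sup>3\<^sup>)\<close>.\<close>

lemma gauss_map_inner:
  assumes "z \<in> quadric_cone" "gauss_map z = (x, y)"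
  shows "x \<bullet> y = 1 - 4 * (cmod (z$3))\<^sup>2 / (norm z)\<^sup>2"
proof -
  obtain \<xi> \<eta> where nz: "\<xi> \<noteq> 0" "\<eta> \<noteq> 0" and z: "z = segre \<xi> \<eta>" using cone_segreE assms by blast
  have "pauli_form \<xi> \<xi> \<bullet> pauli_form \<eta> \<eta> = (norm \<xi>)\<^sup>2 * (norm \<eta>)\<^sup>2 - 8 * (cmod (z$3))\<^sup>2"
    unfolding norm_spinor cmod_power2 z
    by (simp add: segre_nth pauli_form_def inner_vec_def sum_3) (simp add: field_simps power2_eq_square)
  moreover have "x = hopf \<xi>" "y = hopf \<eta>" using assms(2) z gauss_map_segre[OF nz] by auto
  ultimately show ?thesis using nz by (simp add: hopf_def z norm_segre field_simps)
qed

lemma norm_cone: "(norm z)\<^sup>2 = (cmod (z$0))\<^sup>2 + (cmod (z$1))\<^sup>2 + (cmod (z$2))\<^sup>2 + (cmod (z$3))\<^sup>2"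
  for z :: "complex^4"
  by (simp add: norm_vec_def L2_set_def sum_nonneg sum_4_from_0)

text \<open>On the cone both terms under the square root depend only on the norm and on
  \<open>|z\<^sub>3|\<close>, since the quadratic form of the first three coordinates is
  \<open>-z\<^sub>3\<^sup>2\<close>. The condition is in the form in which it meets the inner product formula:
  it becomes the value \<open>-1/2\<close>.\<close>

lemma GZ_lambda3_cone:
  assumes "z \<in> quadric_cone"
  shows "GZ_lambda3 z = 1 \<longleftrightarrow> 4 * (cmod (z$3))\<^sup>2 / (norm z)\<^sup>2 = 3 / 2"
proof -
  let ?n = "(norm z)\<^sup>2" and ?m = "(cmod (z$3))\<^sup>2"
  have n: "?n > 0" using assms by (simp add: quadric_cone_def)
  have "(z$0)\<^sup>2 + (z$1)\<^sup>2 + (z$2)\<^sup>2 = - ((z$3)\<^sup>2)"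
    using assms by (simp add: quadric_cone_def eq_neg_iff_add_eq_0)
  then have e: "cmod ((z$0)\<^sup>2 + (z$1)\<^sup>2 + (z$2)\<^sup>2) = ?m" by (simp add: norm_power)
  have f: "(cmod (z$0))\<^sup>2 + (cmod (z$1))\<^sup>2 + (cmod (z$2))\<^sup>2 = ?n - ?m" by (simp add: norm_cone)
  have "GZ_lambda3 z = 2 / ?n * sqrt (?n\<^sup>2 - 2 * ?n * ?m)"
    unfolding GZ_lambda3_def e f by (simp add: power2_eq_square algebra_simps)
  also have "\<dots> = 1 \<longleftrightarrow> sqrt (?n\<^sup>2 - 2 * ?n * ?m) = ?n / 2" using n by (auto simp: field_simps)
  also have "\<dots> \<longleftrightarrow> ?n\<^sup>2 - 2 * ?n * ?m = (?n / 2)\<^sup>2"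
    using n by (subst real_sqrt_eq_iff[symmetric]) simp
  also have "\<dots> \<longleftrightarrow> ?n * (?n - 2 * ?m) = ?n * (?n / 4)" by (simp add: power2_eq_square algebra_simps)
  also have "\<dots> \<longleftrightarrow> ?n - 2 * ?m = ?n / 4" using n by (simp only: mult_cancel_left) auto
  also have "\<dots> \<longleftrightarrow> 4 * ?m / ?n = 3 / 2" using n by (simp add: field_simps) linarith
  finally show ?thesis .
qed

text \<open>Up to normalisation, \<open>\<lambda>\<^sup>(\<^sup>2\<^sup>)\<close> is the Pluecker coordinate with indices 0 and 1,
  the moment map of the rotation in the plane of the first two coordinates. The sum of the heights
  generates the corresponding simultaneous rotation of the spheres.\<close>

lemma GZ_lambda2_gauss_map:
  assumes "gauss_map z = (x, y)"
  shows "GZ_lambda2 z = x$3 + y$3"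
proof -
  have "x$3 + y$3 = 2 * inverse ((norm z)\<^sup>2) * (2 * plucker 0 1 z)"
    using assms by (auto simp: gauss_map_def self_dual_part_def anti_self_dual_part_def algebra_simps)
  then show ?thesis by (simp add: GZ_lambda2_def plucker_def divide_inverse algebra_simps)
qed

text \<open>Both images are found by rewriting a condition on the cone as a condition on the image
  point.\<close>

lemma image_quadric_locus:
  assumes "T \<subseteq> S2xS2" and "\<And>z. z \<in> quadric_cone \<Longrightarrow> P z \<longleftrightarrow> gauss_map z \<in> T"
  shows "quadric_to_spheres ` hcoord ` {z \<in> quadric_cone. P z} = T"
proof -
  have "quadric_to_spheres ` hcoord ` quadric_cone = S2xS2"
    using bij_quadric_to_spheres unfolding bij_betw_def Q2_def by blast
  then have "gauss_map ` quadric_cone = S2xS2"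
    by (simp add: image_image quadric_to_spheres_hcoord)
  moreover have "quadric_to_spheres ` hcoord ` {z \<in> quadric_cone. P z} = gauss_map ` {z \<in> quadric_cone. P z}"
    by (simp add: image_image quadric_to_spheres_hcoord)
  moreover have "{z \<in> quadric_cone. P z} = {z \<in> quadric_cone. gauss_map z \<in> T}"
    using assms(2) by (intro Collect_cong) auto
  moreover have "gauss_map ` {z \<in> quadric_cone. gauss_map z \<in> T} = gauss_map ` quadric_cone \<inter> T"
    by auto
  ultimately show ?thesis using assms(1) by (simp add: Int_absorb1)
qed

lemma image_GZ_torus: "quadric_to_spheres ` GZ_torus = Chekanov_torus"
  unfolding GZ_torus_def
proof (rule image_quadric_locus)
  show "Chekanov_torus \<subseteq> S2xS2" by (auto simp: Chekanov_torus_def)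
next
  fix z assume z: "z \<in> quadric_cone"
  obtain x y where xy: "gauss_map z = (x, y)" by fastforce
  have "gauss_map z \<in> S2xS2" using z by (rule gauss_map_in_S2xS2)
  then have "gauss_map z \<in> Chekanov_torus \<longleftrightarrow> x$3 + y$3 = 0 \<and> x \<bullet> y = - 1 / 2"
    by (simp add: Chekanov_torus_def xy)
  also have "x \<bullet> y = - 1 / 2 \<longleftrightarrow> 4 * (cmod (z$3))\<^sup>2 / (norm z)\<^sup>2 = 3 / 2"
    unfolding gauss_map_inner[OF z xy] by linarith
  finally show "GZ_lambda2 z = 0 \<and> GZ_lambda3 z = 1 \<longleftrightarrow> gauss_map z \<in> Chekanov_torus"
    by (simp only: GZ_lambda2_gauss_map[OF xy] GZ_lambda3_cone[OF z])
qed

lemma image_Q1: "quadric_to_spheres ` Q1 = S2_diagonal"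
  unfolding Q1_def
proof (rule image_quadric_locus)
  show "S2_diagonal \<subseteq> S2xS2" by (auto simp: S2_diagonal_def S2xS2_def)
next
  fix z assume z: "z \<in> quadric_cone"
  obtain x y where xy: "gauss_map z = (x, y)" by fastforce
  have "gauss_map z \<in> S2xS2" using z by (rule gauss_map_in_S2xS2)
  then have n: "norm x = 1" "norm y = 1" by (auto simp: xy S2xS2_def)
  have "z \<noteq> 0" using z by (simp add: quadric_cone_def)
  then have "z$3 = 0 \<longleftrightarrow> x \<bullet> y = 1" using gauss_map_inner[OF z xy] by simp
  also have "\<dots> \<longleftrightarrow> x = y" using norm_cauchy_schwarz_eq[of x y] n by auto
  also have "\<dots> \<longleftrightarrow> gauss_map z \<in> S2_diagonal" using n by (auto simp: xy S2_diagonal_def)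
  finally show "z$3 = 0 \<longleftrightarrow> gauss_map z \<in> S2_diagonal" .
qed

lemma hamiltonian_isotopic_refl: "hamiltonian_isotopic L L"
proof -
  have "\<exists>X\<in>S2xS2_tangent p. ((\<lambda>s. p) has_vector_derivative X) (at t within {0..1}) \<and>
      (\<forall>w\<in>S2xS2_tangent p. omega_S2xS2 p X w = frechet_derivative (\<lambda>q. 0) (at p) w)" for p t
    by (rule bexI[of _ 0]) (simp_all add: omega_S2xS2_def S2xS2_tangent_def case_prod_unfold)
  then have "hamiltonian_flow (\<lambda>_. 0) (\<lambda>t p. p)"
    unfolding hamiltonian_flow_def by blast
  then have "hamiltonian_diffeo (\<lambda>p. p)"
    unfolding hamiltonian_diffeo_def using smooth_on_const by blast
  then show ?thesis unfolding hamiltonian_isotopic_def by auto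
qed

theorem corollary1p3p3:
  shows "\<exists>\<Phi>. symplectomorphism_Q2_S2xS2 \<Phi> \<and> \<Phi> ` Q1 = S2_diagonal \<and>
              hamiltonian_isotopic (\<Phi> ` GZ_torus) Chekanov_torus"
proof (intro exI conjI)
  show "symplectomorphism_Q2_S2xS2 quadric_to_spheres"
    unfolding symplectomorphism_Q2_S2xS2_def
    using bij_quadric_to_spheres smooth_from_quadric smooth_into_quadric quadric_to_spheres_symplectic
    by blast
qed (simp_all add: image_Q1 image_GZ_torus hamiltonian_isotopic_refl)

end
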